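(* Let $\lambda$ be a nonzero real number and let $Y$ be a random variable whose moment generating function exists in a neighborhood of the origin. Then for all integers $n\ge0$ and real $x$, \[ E\big[S_{n,\lambda}^{Y}(x+Y)\big]=(x)_{n,\lambda}. \]
   Context: For a nonzero real $\lambda$ and any $x$, set $(x)_{0,\lambda}=1$ and $(x)_{n,\lambda}=x(x-\lambda)\cdots(x-(n-1)\lambda)$ for $n\ge1$, and $e_{\lambda}^{x}(t)=\sum_{k\ge0}(x)_{k,\lambda}\frac{t^k}{k!}=(1+\lambda t)^{x/\lambda}$. A random variable $Y$ is assumed to satisfy $E[e^{Yt}]<\infty$ for $|t|<r$ for some $r>0$; then $E[e_\lambda^Y(t)]=E[(1+\lambda t)^{Y/\lambda}]$ is finite and analytic for $t$ near $0$ with value $1$ at $t=0$. The degenerate Sheffer polynomials associated with $Y$ are defined by $\frac{1}{E[e_\lambda^{Y}(t)]}\,e_\lambda^x(t)=\sum_{n\ge0}S_{n,\lambda}^{Y}(x)\frac{t^n}{n!}$. *)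

theory Defs
  imports "HOL-Probability.Probability"
begin

definition deg_falling :: "real \<Rightarrow> real \<Rightarrow> nat \<Rightarrow> real" where
  "deg_falling lam x n = (\<Prod>i<n. x - real i * lam)"

definition deg_exp :: "real \<Rightarrow> real \<Rightarrow> real \<Rightarrow> real" where
  "deg_exp lam x t = (\<Sum>k. deg_falling lam x k * t ^ k / fact k)"

lemma deg_falling_eq_gbinomial:
  assumes "lam \<noteq> 0"
  shows "deg_falling lam x k = fact k * ((x / lam) gchoose k) * lam ^ k"
proof -
  have "deg_falling lam x k = (\<Prod>i<k. (x / lam - real i) * lam)"
    unfolding deg_falling_def using assms by (intro prod.cong) (auto simp: field_simps)
  also have "\<dots> = (\<Prod>i<k. x / lam - real i) * lam ^ k"
    by (simp add: prod.distrib)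
  also have "(\<Prod>i<k. x / lam - real i) = fact k * ((x / lam) gchoose k)"
    by (simp add: gbinomial_prod_rev lessThan_atLeast0)
  finally show ?thesis .
qed

lemma deg_exp_sums:
  assumes "lam \<noteq> 0" and "\<bar>lam * t\<bar> < 1"
  shows "(\<lambda>k. deg_falling lam x k * t ^ k / fact k) sums (1 + lam * t) powr (x / lam)"
  using gen_binomial_real[OF assms(2), of "x / lam"] assms(1)
  by (simp add: deg_falling_eq_gbinomial power_mult_distrib mult_ac)

lemma deg_exp_eq_powr:
  assumes "lam \<noteq> 0" and "\<bar>lam * t\<bar> < 1"
  shows "deg_exp lam x t = (1 + lam * t) powr (x / lam)"
  using deg_exp_sums[OF assms] unfolding deg_exp_def by (rule sums_unique[symmetric])

definition mgf_near_zero :: "'a measure \<Rightarrow> ('a \<Rightarrow> real) \<Rightarrow> bool" where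
  "mgf_near_zero M Y \<longleftrightarrow>
     (\<exists>r>0. \<forall>t. \<bar>t\<bar> < r \<longrightarrow> integrable M (\<lambda>w. exp (Y w * t)))"

text \<open>
  The sequence \<open>S\<close> below is the coefficient sequence of the exponential generating
  function, for fixed \<open>x\<close>. The identity is one of functions of a real \<open>t\<close>
  near \<open>0\<close>, so the sequence is unique whenever it exists. It exists when
  \<open>lam \<noteq> 0\<close>, \<open>M\<close> is a probability space, \<open>Y\<close> is measurable and
  \<open>mgf_near_zero M Y\<close> holds.
\<close>

definition deg_Sheffer :: "'a measure \<Rightarrow> ('a \<Rightarrow> real) \<Rightarrow> real \<Rightarrow> nat \<Rightarrow> real \<Rightarrow> real" where
  "deg_Sheffer M Y lam n x =
     (THE S :: nat \<Rightarrow> real.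
        \<forall>\<^sub>F t in nhds 0.
          (\<lambda>k. S k * t ^ k / fact k) sums
            (1 / (\<integral>w. deg_exp lam (Y w) t \<partial>M) * deg_exp lam x t)) n"

end

theory Submission
  imports Defs
begin

text \<open>
  Write \<open>B x\<close> for the exponential generating series of the degenerate falling factorials of \<open>x\<close>,
  so that \<open>B (x + y) = B x * B y\<close>, and \<open>m\<close> for the coefficientwise expectation of \<open>B Y\<close>.
  The exponential moments of \<open>Y\<close> dominate the series of \<open>deg_exp lam Y\<close>, so \<open>m\<close> converges near
  \<open>0\<close> to the expectation of \<open>deg_exp lam Y\<close>. Hence the generating series of the Sheffer polynomials is
  \<open>inverse m * B x\<close>, and as taking expectations is linear in the coefficients, replacing \<open>x\<close> by
  \<open>x + Y\<close> and averaging gives \<open>inverse m * B x * m = B x\<close>.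
\<close>

section \<open>Uniqueness of power series expansions\<close>

lemma has_fps_expansion_zero_imp_eq_0:
  fixes F :: "'a :: {banach, real_normed_field} fps"
  assumes "(\<lambda>_. 0) has_fps_expansion F"
  shows "F = 0"
proof (rule ccontr)
  assume "F \<noteq> 0"
  define c where "c = fps_nth F (subdegree F)"
  \<comment> \<open>Dividing out the lowest power that occurs leaves a series with constant term
    \<open>c\<close>, while the quotient still vanishes away from 0. Continuity at 0 then forces
    \<open>c = 0\<close>.\<close>
  have "(\<lambda>x. if x = 0 then c else 0 / x ^ subdegree F) has_fps_expansion fps_shift (subdegree F) F"
    by (rule has_fps_expansion_shift[OF assms]) (simp_all add: c_def)
  then have "continuous (at 0) (\<lambda>x::'a. if x = 0 then c else 0 / x ^ subdegree F)"
    by (rule has_fps_expansion_imp_continuous)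
  then have "((\<lambda>x::'a. if x = 0 then c else 0 / x ^ subdegree F) \<longlongrightarrow> c) (at 0)"
    by (simp add: continuous_within)
  then have "((\<lambda>x::'a. 0) \<longlongrightarrow> c) (at 0)"
    by (rule Lim_transform_eventually) (auto simp: eventually_at_filter)
  then have "c = 0"
    by (simp add: tendsto_const_iff)
  with \<open>F \<noteq> 0\<close> show False
    by (simp add: c_def)
qed

lemma has_fps_expansion_unique:
  fixes F G :: "'a :: {banach, real_normed_field} fps"
  assumes "f has_fps_expansion F" and "f has_fps_expansion G"
  shows "F = G"
  using has_fps_expansion_zero_imp_eq_0[of "F - G"] has_fps_expansion_diff[OF assms] by simp

text \<open>Translates the condition inside \<open>deg_Sheffer\<close> into the calculus of
  expansions, where products and inverses are available.\<close>

lemma has_fps_expansion_iff_eventually_sums: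
  fixes f :: "'a :: {banach, real_normed_div_algebra} \<Rightarrow> 'a"
  shows "f has_fps_expansion F \<longleftrightarrow> (\<forall>\<^sub>F t in nhds 0. (\<lambda>n. fps_nth F n * t ^ n) sums f t)"
proof
  assume F: "f has_fps_expansion F"
  then have "\<forall>\<^sub>F t in nhds 0. t \<in> eball 0 (fps_conv_radius F)"
    by (intro eventually_nhds_in_open) (auto simp: has_fps_expansion_def zero_ereal_def)
  moreover have "\<forall>\<^sub>F t in nhds 0. eval_fps F t = f t"
    using F by (simp add: has_fps_expansion_def)
  ultimately show "\<forall>\<^sub>F t in nhds 0. (\<lambda>n. fps_nth F n * t ^ n) sums f t"
    by eventually_elim (use sums_eval_fps[of _ F] in fastforce)
qed (rule has_fps_expansionI)

section \<open>Generating series of the degenerate falling factorials\<close>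

definition deg_fps :: "real \<Rightarrow> real \<Rightarrow> real fps" where
  "deg_fps lam x = Abs_fps (\<lambda>k. deg_falling lam x k / fact k)"

lemma deg_fps_nth: "fps_nth (deg_fps lam x) k = deg_falling lam x k / fact k"
  by (simp add: deg_fps_def)

text \<open>A Vandermonde convolution: each series is a binomial series with exponent
  \<open>z / lam\<close> after the substitution of \<open>lam * X\<close>, and exponents add under
  multiplication.\<close>

lemma deg_fps_add:
  assumes "lam \<noteq> 0"
  shows "deg_fps lam (x + y) = deg_fps lam x * deg_fps lam y"
proof -
  have "deg_fps lam z = fps_binomial (z / lam) oo (fps_const lam * fps_X)" for z
    by (simp add: fps_eq_iff fps_compose_linear deg_fps_nth deg_falling_eq_gbinomial[OF assms])
  then show ?thesis
    by (simp add: add_divide_distrib fps_binomial_add_mult fps_compose_mult_distrib)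
qed

lemma deg_exp_has_fps_expansion:
  assumes "lam \<noteq> 0"
  shows "deg_exp lam x has_fps_expansion deg_fps lam x"
proof (rule has_fps_expansionI)
  have "\<forall>\<^sub>F t in nhds (0::real). t \<in> ball 0 (1 / \<bar>lam\<bar>)"
    using assms by (intro eventually_nhds_in_open) auto
  then show "\<forall>\<^sub>F t in nhds 0. (\<lambda>n. fps_nth (deg_fps lam x) n * t ^ n) sums deg_exp lam x t"
  proof eventually_elim
    case (elim t)
    then have "\<bar>lam * t\<bar> < 1"
      using assms by (simp add: abs_mult field_simps)
    with deg_exp_sums[OF assms this] deg_exp_eq_powr[OF assms this] show ?case
      by (simp add: deg_fps_nth)
  qed
qed

text \<open>Reversing the sign of the step makes every factor
  \<open>\<bar>y\<bar> + i * \<bar>lam\<bar>\<close>, so the majorant is again a falling factorial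
  and its series has a closed form.\<close>

lemma abs_deg_falling_le: "\<bar>deg_falling lam y k\<bar> \<le> deg_falling (- \<bar>lam\<bar>) \<bar>y\<bar> k"
  unfolding deg_falling_def abs_prod
proof (rule prod_mono, safe)
  fix i
  have "\<bar>y - real i * lam\<bar> \<le> \<bar>y\<bar> + \<bar>real i * lam\<bar>"
    by (rule abs_triangle_ineq4)
  then show "\<bar>y - real i * lam\<bar> \<le> \<bar>y\<bar> - real i * - \<bar>lam\<bar>"
    by (simp add: abs_mult)
qed simp

lemma deg_falling_measurable [measurable]:
  "(\<lambda>y. deg_falling lam y k) \<in> borel_measurable borel"
  unfolding deg_falling_def by measurable

text \<open>
  The argument \<open>s\<close> is the solution of \<open>(1 - \<bar>lam\<bar> * s) powr (- 1 / \<bar>lam\<bar>) = exp c\<close>.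
\<close>

lemma abs_deg_falling_power_sums:
  fixes c lam y :: real
  assumes "c > 0" and "lam \<noteq> 0"
  defines "s \<equiv> (1 - exp (- \<bar>lam\<bar> * c)) / \<bar>lam\<bar>"
  shows "(\<lambda>k. deg_falling (- \<bar>lam\<bar>) \<bar>y\<bar> k * s ^ k / fact k) sums exp (c * \<bar>y\<bar>)"
proof -
  have s: "1 + - \<bar>lam\<bar> * s = exp (- \<bar>lam\<bar> * c)"
    using assms by (simp add: s_def)
  have "- \<bar>lam\<bar> * c < 0"
    using assms by simp
  then have "exp (- \<bar>lam\<bar> * c) < 1"
    by (simp only: exp_less_one_iff)
  \<comment> \<open>As \<open>1 - \<bar>lam\<bar> * s\<close> lies strictly between 0 and 1, so does
    \<open>\<bar>lam\<bar> * s\<close>, inside the disc of convergence.\<close>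
  then have "\<bar>- \<bar>lam\<bar> * s\<bar> < 1"
    using s exp_gt_zero[of "- \<bar>lam\<bar> * c"] by linarith
  from deg_exp_sums[OF _ this, of "\<bar>y\<bar>"] show ?thesis
    unfolding s using assms by (simp add: powr_def mult.commute)
qed

section \<open>Moments and the interchange of expectation and series\<close>

locale deg_moments = prob_space M for M :: "'a measure" +
  fixes Y :: "'a \<Rightarrow> real" and lam :: real
  assumes measurable_Y [measurable]: "Y \<in> borel_measurable M"
    and mgf: "mgf_near_zero M Y"
    and lam: "lam \<noteq> 0"
begin

definition moment_fps :: "real fps" where
  "moment_fps = Abs_fps (\<lambda>k. expectation (\<lambda>w. fps_nth (deg_fps lam (Y w)) k))"

text \<open>The exponential of the absolute value is one of the two exponentials at
  \<open>r / 2\<close> and \<open>- (r / 2)\<close>, hence at most their sum; halving keeps both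
  arguments inside the radius.\<close>

lemma ex_integrable_exp_abs: "\<exists>c>0. integrable M (\<lambda>w. exp (c * \<bar>Y w\<bar>))"
proof -
  obtain r where r: "r > 0" "\<And>t. \<bar>t\<bar> < r \<Longrightarrow> integrable M (\<lambda>w. exp (Y w * t))"
    using mgf unfolding mgf_near_zero_def by blast
  have "integrable M (\<lambda>w. exp (Y w * (r / 2)) + exp (Y w * (- (r / 2))))"
    using r(1) by (intro Bochner_Integration.integrable_add r(2)) auto
  then have "integrable M (\<lambda>w. exp (r / 2 * \<bar>Y w\<bar>))"
  proof (rule Bochner_Integration.integrable_bound)
    have "exp (r / 2 * \<bar>y\<bar>) \<le> exp (y * (r / 2)) + exp (y * (- (r / 2)))" for y :: real
      by (cases "y \<ge> 0") (simp_all add: mult.commute)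
    then show "AE w in M. norm (exp (r / 2 * \<bar>Y w\<bar>))
        \<le> norm (exp (Y w * (r / 2)) + exp (Y w * (- (r / 2))))"
      by (intro AE_I2) (simp only: real_norm_def abs_of_pos exp_gt_zero add_pos_pos)
  qed measurable
  with r(1) show ?thesis
    by (intro exI[of _ "r / 2"]) auto
qed

text \<open>For \<open>\<bar>t\<bar> \<le> s\<close> the terms of the series are dominated by
  \<open>b w k\<close>, whose sum over \<open>k\<close> is the integrable
  \<open>exp (c * \<bar>Y w\<bar>)\<close>. This justifies integrating term by term.\<close>

lemma moment_bounds:
  obtains s where "s > 0"
    and "\<And>k. integrable M (\<lambda>w. deg_falling lam (Y w) k)"
    and "\<And>t. \<bar>t\<bar> < s \<Longrightarrow>
      (\<lambda>k. fps_nth moment_fps k * t ^ k) sums expectation (\<lambda>w. deg_exp lam (Y w) t)"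
proof -
  obtain c where c: "c > 0" "integrable M (\<lambda>w. exp (c * \<bar>Y w\<bar>))"
    using ex_integrable_exp_abs by blast
  define s where "s = (1 - exp (- \<bar>lam\<bar> * c)) / \<bar>lam\<bar>"
  define b where "b w k = deg_falling (- \<bar>lam\<bar>) \<bar>Y w\<bar> k * s ^ k / fact k" for w k
  have s: "s > 0"
    using c(1) lam by (simp add: s_def)
  have b_sums: "(\<lambda>k. b w k) sums exp (c * \<bar>Y w\<bar>)" for w
    unfolding b_def s_def by (rule abs_deg_falling_power_sums[OF c(1) lam])
  have b_nonneg: "b w k \<ge> 0" for w k
    unfolding b_def using abs_deg_falling_le[of lam "Y w" k] s by auto
  have b_partial: "(\<Sum>k<n. b w k) \<le> exp (c * \<bar>Y w\<bar>)" for w n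
    using sum_le_suminf[OF sums_summable[OF b_sums], of "{..<n}"] sums_unique[OF b_sums] b_nonneg
    by auto
  have b_le: "b w k \<le> exp (c * \<bar>Y w\<bar>)" for w k
    using b_partial[of w "Suc k"] sum_nonneg[of "{..<k}" "b w"] b_nonneg by simp
  have b_measurable [measurable]: "(\<lambda>w. b w k) \<in> borel_measurable M" for k
    unfolding b_def by measurable
  have b_int: "integrable M (\<lambda>w. b w k)" for k
    by (rule Bochner_Integration.integrable_bound[OF c(2)]) (use b_le b_nonneg in auto)
  \<comment> \<open>The expected partial sums are bounded by the expectation of the full
    sum.\<close>
  have b_summable: "summable (\<lambda>k. expectation (\<lambda>w. b w k))"
  proof (rule summableI_nonneg_bounded)
    fix n
    have "(\<Sum>k<n. expectation (\<lambda>w. b w k)) = expectation (\<lambda>w. \<Sum>k<n. b w k)"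
      using b_int by (simp add: Bochner_Integration.integral_sum)
    also have "\<dots> \<le> expectation (\<lambda>w. exp (c * \<bar>Y w\<bar>))"
      by (intro integral_mono Bochner_Integration.integrable_sum b_int c(2) b_partial)
    finally show "(\<Sum>k<n. expectation (\<lambda>w. b w k)) \<le> expectation (\<lambda>w. exp (c * \<bar>Y w\<bar>))" .
  qed (use b_nonneg in auto)
  have term_le: "\<bar>deg_falling lam (Y w) k * t ^ k / fact k\<bar> \<le> b w k" if "\<bar>t\<bar> \<le> s" for w k t
  proof -
    have "\<bar>deg_falling lam (Y w) k\<bar> * \<bar>t\<bar> ^ k \<le> deg_falling (- \<bar>lam\<bar>) \<bar>Y w\<bar> k * s ^ k"
      using that abs_deg_falling_le[of lam "Y w" k]
      by (intro mult_mono power_mono) auto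
    then show ?thesis
      by (simp add: b_def abs_mult power_abs divide_right_mono)
  qed
  have term_int: "integrable M (\<lambda>w. deg_falling lam (Y w) k * t ^ k / fact k)" if "\<bar>t\<bar> \<le> s" for k t
    by (rule Bochner_Integration.integrable_bound[OF b_int[of k]])
       (use term_le[OF that] b_nonneg in auto)
  show thesis
  proof (rule that[OF s])
    show "integrable M (\<lambda>w. deg_falling lam (Y w) k)" for k
      \<comment> \<open>At the endpoint \<open>t = s\<close> the term is the falling factorial times
        the nonzero constant \<open>s ^ k / fact k\<close>, which can be cancelled.\<close>
      using integrable_mult_right[OF term_int[of s k], of "fact k / s ^ k"] s by simp
    fix t assume t: "\<bar>t\<bar> < s"
    have "(\<lambda>k. expectation (\<lambda>w. deg_falling lam (Y w) k * t ^ k / fact k))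
            sums expectation (\<lambda>w. deg_exp lam (Y w) t)"
      unfolding deg_exp_def
    proof (rule sums_integral)
      show "integrable M (\<lambda>w. deg_falling lam (Y w) k * t ^ k / fact k)" for k
        using t by (intro term_int) simp
      show "AE w in M. summable (\<lambda>k. norm (deg_falling lam (Y w) k * t ^ k / fact k))"
      proof (rule AE_I2)
        show "summable (\<lambda>k. norm (deg_falling lam (Y w) k * t ^ k / fact k))" for w
          by (rule summable_comparison_test'[OF sums_summable[OF b_sums[of w]], of 0])
             (use t term_le in auto)
      qed
      have "norm (expectation (\<lambda>w. norm (deg_falling lam (Y w) k * t ^ k / fact k)))
              \<le> expectation (\<lambda>w. b w k)" for k
      proof -
        have "expectation (\<lambda>w. norm (deg_falling lam (Y w) k * t ^ k / fact k))
                \<le> expectation (\<lambda>w. b w k)"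
          using t term_le by (intro integral_mono integrable_norm term_int b_int) auto
        moreover have "0 \<le> expectation (\<lambda>w. norm (deg_falling lam (Y w) k * t ^ k / fact k))"
          by (rule Bochner_Integration.integral_nonneg) simp
        ultimately show ?thesis
          by simp
      qed
      then show "summable (\<lambda>k. expectation (\<lambda>w. norm (deg_falling lam (Y w) k * t ^ k / fact k)))"
        by (intro summable_comparison_test'[OF b_summable, of 0])
    qed
    then show "(\<lambda>k. fps_nth moment_fps k * t ^ k) sums expectation (\<lambda>w. deg_exp lam (Y w) t)"
      by (simp add: moment_fps_def deg_fps_nth)
  qed
qed

lemma integrable_deg_fps: "integrable M (\<lambda>w. fps_nth (deg_fps lam (Y w)) k)"
  by (rule moment_bounds) (simp add: deg_fps_nth)

lemma moment_has_fps_expansion: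
  "(\<lambda>t. expectation (\<lambda>w. deg_exp lam (Y w) t)) has_fps_expansion moment_fps"
proof (rule moment_bounds)
  fix s :: real
  assume s: "s > 0" and
    sums: "\<And>t. \<bar>t\<bar> < s \<Longrightarrow>
      (\<lambda>k. fps_nth moment_fps k * t ^ k) sums expectation (\<lambda>w. deg_exp lam (Y w) t)"
  have "\<forall>\<^sub>F t in nhds (0::real). t \<in> ball 0 s"
    using s by (intro eventually_nhds_in_open) auto
  then show ?thesis
    by (intro has_fps_expansionI) (auto elim!: eventually_mono intro!: sums)
qed

section \<open>Sheffer polynomials as series coefficients, and their expectation\<close>

lemma moment_fps_nth_0: "fps_nth moment_fps 0 = 1"
  by (simp add: moment_fps_def deg_fps_nth deg_falling_def prob_space)

text \<open>Resolves the \<open>THE\<close>: a sequence exists because \<open>moment_fps\<close> has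
  constant term 1 and is invertible, and it is the only one because expansions are unique.\<close>

lemma deg_Sheffer_eq_fps_nth:
  "deg_Sheffer M Y lam n x = fact n * fps_nth (inverse moment_fps * deg_fps lam x) n"
proof -
  let ?f = "\<lambda>t. 1 / expectation (\<lambda>w. deg_exp lam (Y w) t) * deg_exp lam x t"
  define S where "S n = fact n * fps_nth (inverse moment_fps * deg_fps lam x) n" for n
  have expansion: "?f has_fps_expansion inverse moment_fps * deg_fps lam x"
    using has_fps_expansion_mult[OF
        has_fps_expansion_inverse[OF moment_has_fps_expansion] deg_exp_has_fps_expansion[OF lam]]
    by (simp add: moment_fps_nth_0 inverse_eq_divide)
  have sums_iff: "(\<forall>\<^sub>F t in nhds 0. (\<lambda>k. T k * t ^ k / fact k) sums ?f t) \<longleftrightarrow>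
      ?f has_fps_expansion Abs_fps (\<lambda>k. T k / fact k)" for T :: "nat \<Rightarrow> real"
    by (simp add: has_fps_expansion_iff_eventually_sums)
  have "(THE T :: nat \<Rightarrow> real. \<forall>\<^sub>F t in nhds 0. (\<lambda>k. T k * t ^ k / fact k) sums ?f t) = S"
    unfolding sums_iff
  proof (rule the_equality)
    have "Abs_fps (\<lambda>k. S k / fact k) = inverse moment_fps * deg_fps lam x"
      by (simp add: S_def fps_eq_iff)
    with expansion show "?f has_fps_expansion Abs_fps (\<lambda>k. S k / fact k)"
      by simp
  next
    fix T :: "nat \<Rightarrow> real"
    assume "?f has_fps_expansion Abs_fps (\<lambda>k. T k / fact k)"
    from has_fps_expansion_unique[OF this expansion]
    have "T k / fact k = fps_nth (inverse moment_fps * deg_fps lam x) k" for k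
      by (simp add: fps_eq_iff)
    then have "T k = S k" for k
      unfolding S_def by (simp add: field_simps)
    then show "T = S"
      by auto
  qed
  then show ?thesis
    unfolding deg_Sheffer_def by (simp add: S_def)
qed

text \<open>A coefficient of a product is a finite linear combination of coefficients of
  \<open>deg_fps lam (Y w)\<close> with deterministic weights from \<open>A\<close>, so linearity
  suffices.\<close>

lemma has_bochner_integral_fps_mult_deg_fps:
  "has_bochner_integral M (\<lambda>w. fps_nth (A * deg_fps lam (Y w)) n) (fps_nth (A * moment_fps) n)"
  unfolding fps_mult_nth
  by (intro has_bochner_integral_sum has_bochner_integral_mult_right)
     (simp add: moment_fps_def has_bochner_integral_iff integrable_deg_fps)

lemma has_bochner_integral_deg_Sheffer:
  "has_bochner_integral M (\<lambda>w. deg_Sheffer M Y lam n (x + Y w)) (deg_falling lam x n)"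
proof -
  let ?A = "inverse moment_fps * deg_fps lam x"
  have "?A * moment_fps = (inverse moment_fps * moment_fps) * deg_fps lam x"
    by (simp only: mult_ac)
  also have "\<dots> = deg_fps lam x"
    by (simp add: inverse_mult_eq_1 moment_fps_nth_0)
  finally have "?A * moment_fps = deg_fps lam x" .
  then have "fact n * fps_nth (?A * moment_fps) n = deg_falling lam x n"
    by (simp only: deg_fps_nth) simp
  moreover have "has_bochner_integral M (\<lambda>w. fact n * fps_nth (?A * deg_fps lam (Y w)) n)
      (fact n * fps_nth (?A * moment_fps) n)"
    by (intro has_bochner_integral_mult_right has_bochner_integral_fps_mult_deg_fps)
  \<comment> \<open>\<open>deg_fps_add\<close> splits the series at \<open>x + Y w\<close> into the
    deterministic \<open>?A\<close> and the random factor \<open>deg_fps lam (Y w)\<close>.\<close>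
  ultimately show ?thesis
    by (simp add: deg_Sheffer_eq_fps_nth deg_fps_add[OF lam] mult.assoc)
qed

end

theorem theorem3p1:
  fixes M :: "'a measure" and Y :: "'a \<Rightarrow> real" and lam x :: real and n :: nat
  assumes "prob_space M"
    and "Y \<in> borel_measurable M"
    and "mgf_near_zero M Y"
    and "lam \<noteq> 0"
  shows "integrable M (\<lambda>w. deg_Sheffer M Y lam n (x + Y w)) \<and>
         (\<integral>w. deg_Sheffer M Y lam n (x + Y w) \<partial>M) = deg_falling lam x n"
proof -
  interpret deg_moments M Y lam
    using assms by (simp add: deg_moments_def deg_moments_axioms_def)
  show ?thesis
    using has_bochner_integral_deg_Sheffer[of n x] by (simp add: has_bochner_integral_iff)
qed

end
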